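(* Let $\mathbb{E}$ be a (finite-dimensional) Euclidean space, $f\in\Gamma_0(\mathbb{E})$, $x\in\mathbb{E}$ and $\lambda>0$. Let $P_f(x,\lambda):=P_\lambda f(x)$ on $\mathbb{E}\times\mathbb{R}_{++}$. Then: (a) $P_f$ is semismooth* at $(x,\lambda)$ if $\partial f$ is semismooth* at $\left(P_f(x,\lambda),\ \frac1\lambda[x-P_f(x,\lambda)]\right)$; (b) $P_\lambda f$ is semismooth* at $x$ if and only if $\partial f$ is semismooth* at $\left(P_\lambda f(x),\ \frac1\lambda[x-P_\lambda f(x)]\right)$.
   Context: $\Gamma_0(\mathbb{E})$ denotes the closed proper convex functions $\mathbb{E}\to\mathbb{R}\cup\{+\infty\}$; $\mathbb{R}_{++}=(0,\infty)$. For $\lambda>0$, $P_\lambda f(x)=\mathrm{argmin}_{u\in\mathbb{E}}\{f(u)+\frac1{2\lambda}\|x-u\|^2\}$. For a subset $A$ of a Euclidean space and $\bar a\in A$: the tangent cone $T_A(\bar a)$ is the set of $z$ for which there exist $t_k\downarrow0$, $z_k\to z$ with $\bar a+t_kz_k\in A$; the regular normal cone is $\hat N_A(\bar a)=\{v\mid\langle v,z\rangle\le0\ \forall z\in T_A(\bar a)\}$ (empty if $\bar a\notin A$); the directional normal cone in direction $u$ is $N_A(\bar a;u)=\{v\mid\exists t_k\downarrow0,\ u_k\to u,\ v_k\to v,\ v_k\in\hat N_A(\bar a+t_ku_k)\}$. $A$ is semismooth* at $\bar a$ if $\langle a^*,u\rangle=0$ for all $u$ and all $a^*\in N_A(\bar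 a;u)$. A set-valued map $S$ is semismooth* at $(\bar x,\bar y)\in\mathrm{gph}\,S$ if the set $\mathrm{gph}\,S$ is semismooth* at $(\bar x,\bar y)$; for a single-valued map $F$, semismooth* at $\bar x$ means semismooth* at $(\bar x,F(\bar x))$. *)

theory Defs
  imports "HOL-Analysis.Analysis"
begin

definition epigraph :: "('a \<Rightarrow> ereal) \<Rightarrow> ('a \<times> real) set"
  where "epigraph f = {(x, r). f x \<le> ereal r}"

definition proper_fun :: "('a \<Rightarrow> ereal) \<Rightarrow> bool"
  where "proper_fun f \<longleftrightarrow> (\<forall>x. f x \<noteq> -\<infinity>) \<and> (\<exists>x. f x \<noteq> \<infinity>)"

definition Gamma0 :: "('a::euclidean_space \<Rightarrow> ereal) set"
  where "Gamma0 = {f. proper_fun f \<and> convex (epigraph f) \<and> closed (epigraph f)}"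

definition subdifferential :: "('a::euclidean_space \<Rightarrow> ereal) \<Rightarrow> 'a \<Rightarrow> 'a set"
  where "subdifferential f x =
    {v. \<bar>f x\<bar> \<noteq> \<infinity> \<and> (\<forall>y. f x + ereal (v \<bullet> (y - x)) \<le> f y)}"

text \<open>For \<open>f\<close> in \<^const>\<open>Gamma0\<close> and \<open>lam > 0\<close> the minimizer exists and is unique, so the choice made
  by \<^const>\<open>arg_min\<close> is immaterial.\<close>

definition prox :: "real \<Rightarrow> ('a::euclidean_space \<Rightarrow> ereal) \<Rightarrow> 'a \<Rightarrow> 'a"
  where "prox lam f x = arg_min (\<lambda>u. f u + ereal (1 / (2 * lam) * (norm (x - u))\<^sup>2)) (\<lambda>_. True)"

definition prox_joint :: "('a::euclidean_space \<Rightarrow> ereal) \<Rightarrow> 'a \<times> real \<Rightarrow> 'a"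
  where "prox_joint f = (\<lambda>(x, lam). prox lam f x)"

text \<open>Throughout, \<open>t\<^sub>k \<down> 0\<close> is read as \<open>t\<^sub>k > 0\<close> and \<open>t\<^sub>k \<rightarrow> 0\<close>. Requiring monotonicity as well gives the
  same cones, by passing to subsequences.\<close>

definition tangent_cone :: "'a::euclidean_space set \<Rightarrow> 'a \<Rightarrow> 'a set"
  where "tangent_cone A a =
    {z. \<exists>(t :: nat \<Rightarrow> real) (w :: nat \<Rightarrow> 'a).
          (\<forall>k. t k > 0) \<and> t \<longlonglongrightarrow> 0 \<and> w \<longlonglongrightarrow> z \<and> (\<forall>k. a + t k *\<^sub>R w k \<in> A)}"

definition regular_normal_cone :: "'a::euclidean_space set \<Rightarrow> 'a \<Rightarrow> 'a set"
  where "regular_normal_cone A a =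
    (if a \<in> A then {v. \<forall>z \<in> tangent_cone A a. v \<bullet> z \<le> 0} else {})"

definition directional_normal_cone :: "'a::euclidean_space set \<Rightarrow> 'a \<Rightarrow> 'a \<Rightarrow> 'a set"
  where "directional_normal_cone A a u =
    {v. \<exists>(t :: nat \<Rightarrow> real) (d :: nat \<Rightarrow> 'a) (w :: nat \<Rightarrow> 'a).
          (\<forall>k. t k > 0) \<and> t \<longlonglongrightarrow> 0 \<and> d \<longlonglongrightarrow> u \<and> w \<longlonglongrightarrow> v \<and>
          (\<forall>k. w k \<in> regular_normal_cone A (a + t k *\<^sub>R d k))}"

definition semismooth_star_set :: "'a::euclidean_space set \<Rightarrow> 'a \<Rightarrow> bool"
  where "semismooth_star_set A a \<longleftrightarrow>
    a \<in> A \<and> (\<forall>u. \<forall>v \<in> directional_normal_cone A a u. v \<bullet> u = 0)"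

definition gph :: "('a \<Rightarrow> 'b set) \<Rightarrow> ('a \<times> 'b) set"
  where "gph S = {(x, y). y \<in> S x}"

definition semismooth_star_map ::
    "('a::euclidean_space \<Rightarrow> 'b::euclidean_space set) \<Rightarrow> 'a \<times> 'b \<Rightarrow> bool"
  where "semismooth_star_map S p \<longleftrightarrow> semismooth_star_set (gph S) p"

text \<open>A function with domain \<open>D\<close> is the set-valued map that is a singleton on \<open>D\<close> and empty elsewhere.\<close>

definition semismooth_star_on ::
    "'a::euclidean_space set \<Rightarrow> ('a \<Rightarrow> 'b::euclidean_space) \<Rightarrow> 'a \<Rightarrow> bool"
  where "semismooth_star_on D F x \<longleftrightarrow>
    semismooth_star_map (\<lambda>z. if z \<in> D then {F z} else {}) (x, F x)"

end

theory Submission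
  imports Defs
begin

text \<open>
  The optimality condition for the strongly convex problem defining the proximal point reads
  \<open>u = prox lam f x\<close> iff \<open>(x - u) / lam\<close> is a subgradient of \<open>f\<close> at \<open>u\<close>
  (\<open>prox_eq_iff_subgradient\<close>): a minimizer exists because \<open>f\<close> has an affine minorant, minimizers
  satisfy the inclusion, and monotonicity of the subdifferential leaves only one solution of the
  inclusion. Hence the graph of the proximal map is the preimage of the graph of
  the subdifferential under \<open>(x, u) \<mapsto> (u, (x - u) / lam)\<close>.

  For fixed \<open>lam\<close> this is a linear bijection \<open>L\<close>. Tangent cones are mapped by \<open>L\<close>, directions by
  \<open>L\<close>, and normals by the adjoint of the inverse of \<open>L\<close>, so the pairings of normals with directions
  do not change and semismoothness* is preserved both ways (\<open>semismooth_star_set_linear_vimage\<close>).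

  If \<open>lam\<close> varies too, then \<open>((x, lam), u) \<mapsto> (u, (x - u) / lam)\<close> is a nonlinear submersion, with
  the fibres parametrized by \<open>lam\<close> through \<open>((u, v), lam) \<mapsto> ((u + lam v, lam), u)\<close>. Differentiating
  this parametrization shows that every regular normal \<open>((a, \<alpha>), b)\<close> to the preimage of \<open>B\<close>
  annihilates the fibre, \<open>a \<bullet> v + \<alpha> = 0\<close>, and that \<open>(a + b, lam a)\<close> is a regular normal to \<open>B\<close>
  (\<open>regular_normal_resolvent_preimage\<close>). Both facts pass to the limit, and the pairing with the
  direction is again the pairing of the transported objects. Only preservation from \<open>B\<close> to its
  preimage is obtained in this case.
\<close>

section \<open>Proximal points and subgradients\<close>

text \<open>Closed proper convex functions have an affine minorant. It comes from separating the point
  \<open>(x0, f x0 - 1)\<close> from the epigraph; the separating hyperplane is not vertical because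
  \<open>(x0, f x0)\<close> belongs to the epigraph.\<close>

lemma Gamma0_affine_minorant:
  fixes f :: "'a::euclidean_space \<Rightarrow> ereal"
  assumes "f \<in> Gamma0"
  obtains a :: 'a and c :: real where "\<And>u r. (u, r) \<in> epigraph f \<Longrightarrow> a \<bullet> u + c \<le> r"
proof -
  from assms have pr: "proper_fun f" and cv: "convex (epigraph f)" and cl: "closed (epigraph f)"
    by (auto simp: Gamma0_def)
  from pr obtain x0 r0 where x0: "f x0 = ereal r0"
    unfolding proper_fun_def by (metis ereal_cases)
  have "(x0, r0 - 1) \<notin> epigraph f"
    by (simp add: epigraph_def x0)
  from separating_hyperplane_closed_point[OF cv cl this]
  obtain p b where lo: "p \<bullet> (x0, r0 - 1) < b" and hi: "\<And>y. y \<in> epigraph f \<Longrightarrow> b < p \<bullet> y"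
    by blast
  obtain a \<beta> where p: "p = (a, \<beta>)" by (cases p)
  have "b < p \<bullet> (x0, r0)"
    by (rule hi) (simp add: epigraph_def x0)
  with lo have \<beta>: "\<beta> > 0"
    by (simp add: p algebra_simps)
  have "(- (1 / \<beta>) *\<^sub>R a) \<bullet> u + b / \<beta> \<le> r" if "(u, r) \<in> epigraph f" for u r
    using hi[OF that] \<beta> by (simp add: p field_simps)
  then show thesis by (rule that)
qed

text \<open>Existence is proved in the epigraph, where the objective \<open>q (u, r) = r + |x - u|^2 / (2 lam)\<close> is
  continuous; the affine minorant makes its sublevel sets on the epigraph compact.\<close>

lemma proximal_minimizer_exists:
  fixes f :: "'a::euclidean_space \<Rightarrow> ereal"
  assumes f: "f \<in> Gamma0" and lam: "lam > 0"
  shows "\<exists>u. \<forall>y. f u + ereal (1 / (2 * lam) * (norm (x - u))\<^sup>2)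
                  \<le> f y + ereal (1 / (2 * lam) * (norm (x - y))\<^sup>2)"
proof -
  from f have pr: "proper_fun f" and cl: "closed (epigraph f)"
    by (auto simp: Gamma0_def)
  from pr obtain x0 r0 where x0: "f x0 = ereal r0"
    unfolding proper_fun_def by (metis ereal_cases)
  obtain a c where minor: "\<And>u r. (u, r) \<in> epigraph f \<Longrightarrow> a \<bullet> u + c \<le> r"
    using Gamma0_affine_minorant[OF f] by blast
  define q where "q = (\<lambda>z::'a \<times> real. snd z + 1 / (2 * lam) * (norm (x - fst z))\<^sup>2)"
  define M where "M = q (x0, r0)"
  define S where "S = {z \<in> epigraph f. q z \<le> M}"
  have contq: "continuous_on T q" for T
    unfolding q_def by (intro continuous_intros)
  have z0: "(x0, r0) \<in> S"
    by (simp add: S_def M_def epigraph_def x0)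
  have "closed {z. q z \<le> M}"
    by (intro closed_Collect_le contq continuous_on_const)
  then have "closed S"
    using cl closed_Int[of "epigraph f" "{z. q z \<le> M}"] by (simp add: S_def Int_def)
  moreover have "bounded S"
  proof -
    define N where "N = \<bar>M\<bar> + \<bar>a \<bullet> x\<bar> + \<bar>c\<bar>"
    define K where "K = 2 * lam * (norm a + N) + 1"
    have N: "N \<ge> 0" by (simp add: N_def)
    have K1: "K \<ge> 1" using lam N by (simp add: K_def)
    have "norm (u - x) \<le> K \<and> \<bar>r\<bar> \<le> \<bar>M\<bar> + norm a * (norm x + K) + \<bar>c\<bar>" if "(u, r) \<in> S" for u r
    proof -
      define n where "n = norm (u - x)"
      have e: "(u, r) \<in> epigraph f" and qM: "r + 1 / (2 * lam) * n\<^sup>2 \<le> M"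
        using that by (auto simp: S_def q_def n_def norm_minus_commute)
      have r: "a \<bullet> u + c \<le> r" by (rule minor[OF e])
      have an: "\<bar>a \<bullet> (u - x)\<bar> \<le> norm a * n"
        unfolding n_def by (rule Cauchy_Schwarz_ineq2)
      have au: "a \<bullet> u = a \<bullet> x + a \<bullet> (u - x)" by (simp add: inner_diff_right)
      have quad: "1 / (2 * lam) * n\<^sup>2 \<le> N + norm a * n"
        using qM r an au by (simp add: N_def)
      have "n \<le> K"
      proof (rule ccontr)
        assume "\<not> n \<le> K"
        then have nK: "n > K" by simp
        have n1: "n \<ge> 1" using nK K1 by simp
        have "N + norm a * n \<le> (N + norm a) * n"
          using mult_left_mono[OF n1 N] by (simp add: algebra_simps)
        with quad have "1 / (2 * lam) * n * n \<le> (N + norm a) * n"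
          by (simp add: power2_eq_square)
        then have "1 / (2 * lam) * n \<le> N + norm a"
          using n1 mult_right_le_imp_le[of "1 / (2 * lam) * n" n "N + norm a"] by simp
        then have "n \<le> 2 * lam * (norm a + N)"
          using lam by (simp add: field_simps)
        with nK show False by (simp add: K_def)
      qed
      moreover have "r \<le> M"
        using qM lam by (smt (verit) divide_nonneg_pos mult_nonneg_nonneg zero_le_power2)
      moreover have "norm u \<le> norm x + K"
        using \<open>n \<le> K\<close> norm_triangle_ineq[of x "u - x"] by (simp add: n_def)
      then have "\<bar>a \<bullet> u\<bar> \<le> norm a * (norm x + K)"
        using Cauchy_Schwarz_ineq2[of a u] by (smt (verit) mult_left_mono norm_ge_zero)
      ultimately show ?thesis
        using r by (auto simp: n_def)
    qed
    then have "S \<subseteq> cball x K \<times> cball 0 (\<bar>M\<bar> + norm a * (norm x + K) + \<bar>c\<bar>)"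
      by (auto simp: dist_norm norm_minus_commute)
    then show ?thesis
      by (rule bounded_subset[rotated]) (intro bounded_Times bounded_cball)
  qed
  ultimately have "compact S" by (simp add: compact_eq_bounded_closed)
  then obtain z where zS: "z \<in> S" and zmin: "\<And>y. y \<in> S \<Longrightarrow> q z \<le> q y"
    using continuous_attains_inf[OF _ _ contq, of S] z0 by blast
  have zmin': "q z \<le> q y" if "y \<in> epigraph f" for y
    using zmin[of y] zmin[OF z0] that by (cases "q y \<le> M") (auto simp: S_def M_def)
  obtain u r where z: "z = (u, r)" by (cases z)
  show ?thesis
  proof (intro exI[of _ u] allI)
    fix y
    have ur: "f u \<le> ereal r" using zS by (simp add: S_def z epigraph_def)
    show "f u + ereal (1 / (2 * lam) * (norm (x - u))\<^sup>2)
          \<le> f y + ereal (1 / (2 * lam) * (norm (x - y))\<^sup>2)"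
    proof (cases "f y")
      case (real s)
      have "q z \<le> q (y, s)" by (rule zmin') (simp add: epigraph_def real)
      then have "ereal r + ereal (1 / (2 * lam) * (norm (x - u))\<^sup>2)
                 \<le> f y + ereal (1 / (2 * lam) * (norm (x - y))\<^sup>2)"
        by (simp add: q_def z real)
      then show ?thesis
        using add_right_mono[OF ur] order_trans by blast
    next
      case MInf
      then show ?thesis using pr by (simp add: proper_fun_def)
    qed simp
  qed
qed

lemma proximal_minimizer_subgradient:
  fixes f :: "'a::euclidean_space \<Rightarrow> ereal"
  assumes f: "f \<in> Gamma0" and lam: "lam > 0"
    and min: "\<And>y. f u + ereal (1 / (2 * lam) * (norm (x - u))\<^sup>2)
                  \<le> f y + ereal (1 / (2 * lam) * (norm (x - y))\<^sup>2)"
  shows "(1 / lam) *\<^sub>R (x - u) \<in> subdifferential f u"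
proof -
  from f have pr: "proper_fun f" and cv: "convex (epigraph f)"
    by (auto simp: Gamma0_def)
  from pr obtain x0 r0 where x0: "f x0 = ereal r0"
    unfolding proper_fun_def by (metis ereal_cases)
  obtain s where s: "f u = ereal s"
    using min[of x0] pr by (cases "f u") (auto simp: x0 proper_fun_def)
  have "ereal s + ereal (((1 / lam) *\<^sub>R (x - u)) \<bullet> (y - u)) \<le> f y" for y
  proof (cases "f y")
    case (real r)
    define i where "i = (x - u) \<bullet> (y - u) / lam"
    define k where "k = (norm (y - u))\<^sup>2 / (2 * lam)"
    \<comment> \<open>Compare \<open>u\<close> with the points of the segment from \<open>u\<close> to \<open>y\<close> close to \<open>u\<close>.\<close>
    have step: "i \<le> r - s + t * k" if t: "0 < t" "t < 1" for t
    proof -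
      have "(1 - t) *\<^sub>R (u, s) + t *\<^sub>R (y, r) \<in> epigraph f"
        using t by (intro convexD[OF cv]) (auto simp: epigraph_def s real)
      moreover have "(1 - t) *\<^sub>R (u, s) + t *\<^sub>R (y, r) = (u + t *\<^sub>R (y - u), s + t * (r - s))"
        by (simp add: algebra_simps)
      ultimately have "f (u + t *\<^sub>R (y - u)) \<le> ereal (s + t * (r - s))"
        by (simp add: epigraph_def)
      then have "ereal s + ereal (1 / (2 * lam) * (norm (x - u))\<^sup>2)
         \<le> ereal (s + t * (r - s)) + ereal (1 / (2 * lam) * (norm (x - (u + t *\<^sub>R (y - u))))\<^sup>2)"
        using min[of "u + t *\<^sub>R (y - u)"] add_right_mono order_trans unfolding s by blast
      then have 1: "1 / (2 * lam) * (norm (x - u))\<^sup>2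
         \<le> t * (r - s) + 1 / (2 * lam) * (norm (x - (u + t *\<^sub>R (y - u))))\<^sup>2"
        by simp
      define v w where "v = x - u" and "w = y - u"
      have "(norm (v - t *\<^sub>R w))\<^sup>2 = (norm v)\<^sup>2 - 2 * t * (v \<bullet> w) + t\<^sup>2 * (norm w)\<^sup>2"
        unfolding power2_norm_eq_inner
        by (simp add: inner_diff_left inner_diff_right inner_commute power2_eq_square)
      then have 2: "(norm (x - (u + t *\<^sub>R (y - u))))\<^sup>2
          = (norm (x - u))\<^sup>2 - 2 * t * ((x - u) \<bullet> (y - u)) + t\<^sup>2 * (norm (y - u))\<^sup>2"
        by (simp add: v_def w_def diff_diff_eq)
      have "1 / (2 * lam) * (norm (x - (u + t *\<^sub>R (y - u))))\<^sup>2
          = 1 / (2 * lam) * (norm (x - u))\<^sup>2 - t * i + t * (t * k)"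
        unfolding 2 i_def k_def using lam by (simp add: field_simps power2_eq_square)
      with 1 have "t * i \<le> t * (r - s + t * k)"
        by (simp add: algebra_simps)
      then show ?thesis using t by simp
    qed
    have "i \<le> r - s"
    proof (rule tendsto_lowerbound)
      show "((\<lambda>t. r - s + t * k) \<longlongrightarrow> r - s) (at_right 0)"
        by (auto intro!: tendsto_eq_intros)
      show "\<forall>\<^sub>F t in at_right 0. i \<le> r - s + t * k"
        by (rule eventually_at_rightI[of 0 1]) (auto intro: step)
    qed simp
    then show ?thesis by (simp add: real i_def)
  next
    case MInf
    then show ?thesis using pr by (simp add: proper_fun_def)
  qed simp
  then show ?thesis by (simp add: subdifferential_def s)
qed

lemma subdifferential_monotone:
  assumes "v \<in> subdifferential f u" "w \<in> subdifferential f y"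
  shows "(v - w) \<bullet> (u - y) \<ge> 0"
proof -
  have "f u + ereal (v \<bullet> (y - u)) \<le> f y" "f y + ereal (w \<bullet> (u - y)) \<le> f u"
    and "\<bar>f u\<bar> \<noteq> \<infinity>" "\<bar>f y\<bar> \<noteq> \<infinity>"
    using assms by (auto simp: subdifferential_def)
  then show ?thesis
    by (cases "f u"; cases "f y") (auto simp: inner_diff_left inner_diff_right)
qed

lemma prox_eq_iff_subgradient:
  fixes f :: "'a::euclidean_space \<Rightarrow> ereal"
  assumes f: "f \<in> Gamma0" and lam: "lam > 0"
  shows "prox lam f x = u \<longleftrightarrow> (1 / lam) *\<^sub>R (x - u) \<in> subdifferential f u"
proof -
  define h where "h = (\<lambda>u. f u + ereal (1 / (2 * lam) * (norm (x - u))\<^sup>2))"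
  have "\<exists>u. is_arg_min h (\<lambda>_. True) u"
    using proximal_minimizer_exists[OF f lam, of x] by (auto simp: is_arg_min_linorder h_def)
  then have "is_arg_min h (\<lambda>_. True) (prox lam f x)"
    unfolding prox_def arg_min_def h_def by (rule someI_ex)
  then have sub: "(1 / lam) *\<^sub>R (x - prox lam f x) \<in> subdifferential f (prox lam f x)"
    by (intro proximal_minimizer_subgradient f lam) (auto simp: is_arg_min_linorder h_def)
  have "prox lam f x = u" if "(1 / lam) *\<^sub>R (x - u) \<in> subdifferential f u"
  proof -
    define d where "d = prox lam f x - u"
    have "(1 / lam) *\<^sub>R (x - prox lam f x) - (1 / lam) *\<^sub>R (x - u) = - (1 / lam) *\<^sub>R d"
      by (simp add: d_def algebra_simps)
    then have "(- (1 / lam) *\<^sub>R d) \<bullet> d \<ge> 0"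
      using subdifferential_monotone[OF sub that] by (simp only: d_def)
    then have "d \<bullet> d \<le> 0"
      using lam by (simp add: divide_le_0_iff)
    then have "d = 0" by (metis inner_gt_zero_iff not_less)
    then show ?thesis by (simp add: d_def)
  qed
  with sub show ?thesis by blast
qed

section \<open>Semismoothness* of preimages\<close>

lemma tangent_coneI:
  assumes "\<And>k. t k > 0" "t \<longlonglongrightarrow> 0" "w \<longlonglongrightarrow> z" "\<And>k. a + t k *\<^sub>R w k \<in> A"
  shows "z \<in> tangent_cone A a"
  using assms unfolding tangent_cone_def by blast

lemma directional_normal_coneI:
  assumes "\<And>k. t k > 0" "t \<longlonglongrightarrow> 0" "d \<longlonglongrightarrow> u" "w \<longlonglongrightarrow> v"
    "\<And>k. w k \<in> regular_normal_cone A (a + t k *\<^sub>R d k)"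
  shows "v \<in> directional_normal_cone A a u"
  using assms unfolding directional_normal_cone_def by blast

lemma linear_tendsto:
  fixes L :: "'a::euclidean_space \<Rightarrow> 'b::real_normed_vector"
  assumes "linear L" "(h \<longlongrightarrow> l) F"
  shows "((\<lambda>k. L (h k)) \<longlongrightarrow> L l) F"
  using assms bounded_linear.tendsto linear_conv_bounded_linear by blast

lemma regular_normal_linear_vimage:
  fixes L :: "'a::euclidean_space \<Rightarrow> 'b::euclidean_space"
  assumes L: "linear L" and g: "linear g" and Lg: "\<And>y. L (g y) = y"
    and v: "v \<in> regular_normal_cone (L -` B) a"
  shows "adjoint g v \<in> regular_normal_cone B (L a)"
proof -
  have a: "L a \<in> B" and vn: "\<And>z. z \<in> tangent_cone (L -` B) a \<Longrightarrow> v \<bullet> z \<le> 0"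
    using v by (auto simp: regular_normal_cone_def split: if_splits)
  have "adjoint g v \<bullet> z \<le> 0" if z: "z \<in> tangent_cone B (L a)" for z
  proof -
    obtain t w where t: "\<And>k. t k > 0" "t \<longlonglongrightarrow> 0" and w: "w \<longlonglongrightarrow> z"
      and B: "\<And>k. L a + t k *\<^sub>R w k \<in> B"
      using z unfolding tangent_cone_def by blast
    have "g z \<in> tangent_cone (L -` B) a"
      by (rule tangent_coneI[OF t linear_tendsto[OF g w]])
         (simp add: B linear_add[OF L] linear_scale[OF L] Lg)
    then show ?thesis
      using vn[of "g z"] by (simp add: adjoint_clauses[OF g] inner_commute)
  qed
  with a show ?thesis by (simp add: regular_normal_cone_def)
qed

lemma semismooth_star_set_linear_vimage:
  fixes L :: "'a::euclidean_space \<Rightarrow> 'b::euclidean_space"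
  assumes L: "linear L" and g: "linear g" and Lg: "\<And>y. L (g y) = y" and gL: "\<And>y. g (L y) = y"
    and ss: "semismooth_star_set B (L a)"
  shows "semismooth_star_set (L -` B) a"
  unfolding semismooth_star_set_def
proof (intro conjI allI ballI)
  show "a \<in> L -` B" using ss by (simp add: semismooth_star_set_def)
next
  fix u v assume "v \<in> directional_normal_cone (L -` B) a u"
  then obtain t d w where t: "\<And>k. t k > 0" "t \<longlonglongrightarrow> 0" and d: "d \<longlonglongrightarrow> u" and w: "w \<longlonglongrightarrow> v"
      and n: "\<And>k. w k \<in> regular_normal_cone (L -` B) (a + t k *\<^sub>R d k)"
    unfolding directional_normal_cone_def by blast
  have "adjoint g v \<in> directional_normal_cone B (L a) (L u)"
  proof (rule directional_normal_coneI[OF t])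
    show "(\<lambda>k. L (d k)) \<longlonglongrightarrow> L u" by (rule linear_tendsto[OF L d])
    show "(\<lambda>k. adjoint g (w k)) \<longlonglongrightarrow> adjoint g v"
      by (rule linear_tendsto[OF adjoint_linear[OF g] w])
    show "adjoint g (w k) \<in> regular_normal_cone B (L a + t k *\<^sub>R L (d k))" for k
      using regular_normal_linear_vimage[OF L g Lg n]
      by (simp add: linear_add[OF L] linear_scale[OF L])
  qed
  then have "adjoint g v \<bullet> L u = 0"
    using ss by (simp add: semismooth_star_set_def)
  then show "v \<bullet> u = 0"
    by (simp add: adjoint_clauses[OF g] gL inner_commute)
qed

text \<open>The set of all \<open>((x, lam), u)\<close> with \<open>lam > 0\<close> and \<open>(u, (x - u) / lam)\<close> in \<open>B\<close>. If \<open>B\<close> is the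
  graph of an operator, this is the graph of its resolvent as a function of \<open>x\<close> and \<open>lam\<close>.\<close>

definition resolvent_preimage :: "('a::euclidean_space \<times> 'a) set \<Rightarrow> (('a \<times> real) \<times> 'a) set"
  where "resolvent_preimage B = {((x, lam), u). lam > 0 \<and> (u, (1 / lam) *\<^sub>R (x - u)) \<in> B}"

text \<open>The point of the preimage is written as \<open>((u + lam v, lam), u)\<close>, that is, in terms of its image
  \<open>(u, v)\<close> and of the parameter \<open>lam\<close> of the fibre.\<close>

lemma regular_normal_resolvent_preimage:
  fixes B :: "('a::euclidean_space \<times> 'a) set"
  assumes n: "((a, \<alpha>), b) \<in> regular_normal_cone (resolvent_preimage B) ((u + lam *\<^sub>R v, lam), u)"
  shows "lam > 0" and "a \<bullet> v + \<alpha> = 0" and "(a + b, lam *\<^sub>R a) \<in> regular_normal_cone B (u, v)"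
proof -
  have "((u + lam *\<^sub>R v, lam), u) \<in> resolvent_preimage B"
    using n by (auto simp: regular_normal_cone_def split: if_splits)
  then have lam: "lam > 0" and uv: "(u, v) \<in> B"
    by (auto simp: resolvent_preimage_def)
  show "lam > 0" by (rule lam)
  define T where "T = tangent_cone (resolvent_preimage B) ((u + lam *\<^sub>R v, lam), u)"
  have pol: "((a, \<alpha>), b) \<bullet> z \<le> 0" if "z \<in> T" for z
    using n that by (auto simp: T_def regular_normal_cone_def split: if_splits)
  \<comment> \<open>The factor \<open>1 / 2\<close> keeps the parameter \<open>lam + t k * \<mu>\<close> positive for all \<open>k\<close> if \<open>\<bar>\<mu>\<bar> \<le> 1\<close>.\<close>
  define t where "t = (\<lambda>k. lam / 2 * inverse (real (Suc k)))"
  have t: "t k > 0" for k using lam by (simp add: t_def)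
  have fibre: "((\<mu> *\<^sub>R v, \<mu>), 0) \<in> T" if \<mu>: "\<bar>\<mu>\<bar> \<le> 1" for \<mu>
    unfolding T_def
  proof (rule tangent_coneI[OF t])
    show "t \<longlonglongrightarrow> 0"
      unfolding t_def using LIMSEQ_inverse_real_of_nat by (rule tendsto_mult_right_zero)
    show "(\<lambda>k. ((\<mu> *\<^sub>R v, \<mu>), 0::'a)) \<longlonglongrightarrow> ((\<mu> *\<^sub>R v, \<mu>), 0)" by simp
    fix k
    have "inverse (real (Suc k)) \<le> 1" by (simp add: inverse_le_1_iff)
    then have "t k \<le> lam / 2" using lam by (simp add: t_def mult_left_le)
    moreover have "\<bar>t k * \<mu>\<bar> \<le> t k" using t[of k] \<mu> by (simp add: abs_mult mult_left_le)
    ultimately have pos: "lam + t k * \<mu> > 0" using lam by linarith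
    have "u + lam *\<^sub>R v + t k *\<^sub>R \<mu> *\<^sub>R v - u = (lam + t k * \<mu>) *\<^sub>R v"
      by (simp add: algebra_simps)
    then show "((u + lam *\<^sub>R v, lam), u) + t k *\<^sub>R ((\<mu> *\<^sub>R v, \<mu>), 0) \<in> resolvent_preimage B"
      using pos uv by (simp add: resolvent_preimage_def)
  qed
  show "a \<bullet> v + \<alpha> = 0"
    using pol[OF fibre[of 1]] pol[OF fibre[of "-1"]]
    by (simp add: inner_commute)
  have lift: "((z1 + lam *\<^sub>R z2, 0), z1) \<in> T" if z: "(z1, z2) \<in> tangent_cone B (u, v)" for z1 z2
  proof -
    obtain t w where t: "\<And>k. t k > 0" "t \<longlonglongrightarrow> 0" and w: "w \<longlonglongrightarrow> (z1, z2)"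
      and B: "\<And>k. (u, v) + t k *\<^sub>R w k \<in> B"
      using z unfolding tangent_cone_def by blast
    have w1: "(\<lambda>k. fst (w k)) \<longlonglongrightarrow> z1" and w2: "(\<lambda>k. snd (w k)) \<longlonglongrightarrow> z2"
      using tendsto_fst[OF w] tendsto_snd[OF w] by simp_all
    show ?thesis
      unfolding T_def
    proof (rule tangent_coneI[OF t])
      show "(\<lambda>k. ((fst (w k) + lam *\<^sub>R snd (w k), 0), fst (w k)))
              \<longlonglongrightarrow> ((z1 + lam *\<^sub>R z2, 0::real), z1)"
        by (intro tendsto_intros w1 w2)
      fix k
      have "u + lam *\<^sub>R v + t k *\<^sub>R (fst (w k) + lam *\<^sub>R snd (w k)) - (u + t k *\<^sub>R fst (w k))
            = lam *\<^sub>R (v + t k *\<^sub>R snd (w k))"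
        by (simp add: algebra_simps)
      moreover have "(u + t k *\<^sub>R fst (w k), v + t k *\<^sub>R snd (w k)) \<in> B"
        using B[of k] by (simp add: plus_prod_def)
      ultimately show "((u + lam *\<^sub>R v, lam), u)
          + t k *\<^sub>R ((fst (w k) + lam *\<^sub>R snd (w k), 0), fst (w k)) \<in> resolvent_preimage B"
        using lam by (simp add: resolvent_preimage_def)
    qed
  qed
  have "(a + b, lam *\<^sub>R a) \<bullet> z \<le> 0" if z: "z \<in> tangent_cone B (u, v)" for z
    using pol[OF lift[of "fst z" "snd z"]] z
    by (cases z) (simp add: inner_add_left inner_add_right)
  then show "(a + b, lam *\<^sub>R a) \<in> regular_normal_cone B (u, v)"
    using uv by (simp add: regular_normal_cone_def)
qed

lemma semismooth_star_set_resolvent_preimage: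
  fixes B :: "('a::euclidean_space \<times> 'a) set"
  assumes lam: "lam > 0" and ss: "semismooth_star_set B (p, (1 / lam) *\<^sub>R (x - p))"
  shows "semismooth_star_set (resolvent_preimage B) ((x, lam), p)"
  unfolding semismooth_star_set_def
proof (intro conjI allI ballI)
  show "((x, lam), p) \<in> resolvent_preimage B"
    using ss lam by (simp add: semismooth_star_set_def resolvent_preimage_def)
next
  fix dir nrm assume "nrm \<in> directional_normal_cone (resolvent_preimage B) ((x, lam), p) dir"
  then obtain t d w where t: "\<And>k. t k > 0" "t \<longlonglongrightarrow> 0" and d: "d \<longlonglongrightarrow> dir" and w: "w \<longlonglongrightarrow> nrm"
      and n: "\<And>k. w k \<in> regular_normal_cone (resolvent_preimage B) (((x, lam), p) + t k *\<^sub>R d k)"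
    unfolding directional_normal_cone_def by blast
  obtain dx dl du where dir: "dir = ((dx, dl), du)" by (metis surj_pair)
  obtain a \<alpha> b where nrm: "nrm = ((a, \<alpha>), b)" by (metis surj_pair)
  define dxk dlk duk where "dxk k = fst (fst (d k))" "dlk k = snd (fst (d k))" "duk k = snd (d k)" for k
  define ak \<alpha>k bk where "ak k = fst (fst (w k))" "\<alpha>k k = snd (fst (w k))" "bk k = snd (w k)" for k
  have dk: "d k = ((dxk k, dlk k), duk k)" and wk: "w k = ((ak k, \<alpha>k k), bk k)" for k
    by (simp_all add: dxk_dlk_duk_def ak_\<alpha>k_bk_def)
  have lims: "dxk \<longlonglongrightarrow> dx" "dlk \<longlonglongrightarrow> dl" "duk \<longlonglongrightarrow> du" "ak \<longlonglongrightarrow> a" "\<alpha>k \<longlonglongrightarrow> \<alpha>" "bk \<longlonglongrightarrow> b"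
    using tendsto_fst[OF tendsto_fst[OF d]] tendsto_snd[OF tendsto_fst[OF d]] tendsto_snd[OF d]
      tendsto_fst[OF tendsto_fst[OF w]] tendsto_snd[OF tendsto_fst[OF w]] tendsto_snd[OF w]
    by (simp_all add: dir nrm dxk_dlk_duk_def[abs_def] ak_\<alpha>k_bk_def[abs_def])
  define v where "v = (1 / lam) *\<^sub>R (x - p)"
  have xp: "x - p = lam *\<^sub>R v" using lam by (simp add: v_def)
  define lk where "lk k = lam + t k * dlk k" for k
  \<comment> \<open>The difference quotient of \<open>((x, lam), p) \<mapsto> (x - p) / lam\<close> along \<open>t k *\<^sub>R d k\<close>.\<close>
  define ek where "ek k = (1 / lk k) *\<^sub>R (dxk k - duk k - dlk k *\<^sub>R v)" for k
  define e where "e = (1 / lam) *\<^sub>R (dx - du - dl *\<^sub>R v)"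
  have lk: "lk \<longlonglongrightarrow> lam"
    unfolding lk_def using tendsto_add[OF tendsto_const tendsto_mult[OF t(2) lims(2)], of lam] by simp
  have ek: "ek \<longlonglongrightarrow> e"
    unfolding ek_def e_def using lam by (intro tendsto_intros lk lims) simp
  have nk: "((ak k, \<alpha>k k), bk k) \<in> regular_normal_cone (resolvent_preimage B)
              ((x + t k *\<^sub>R dxk k, lk k), p + t k *\<^sub>R duk k)" for k
    using n[of k] by (simp add: dk wk lk_def)
  have lkpos: "lk k > 0" for k
    using nk[of k] by (auto simp: regular_normal_cone_def resolvent_preimage_def split: if_splits)
  have xk: "x + t k *\<^sub>R dxk k = (p + t k *\<^sub>R duk k) + lk k *\<^sub>R (v + t k *\<^sub>R ek k)" for k
  proof -
    have "lk k *\<^sub>R (v + t k *\<^sub>R ek k)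
        = lk k *\<^sub>R v + t k *\<^sub>R (dxk k - duk k - dlk k *\<^sub>R v)"
      using lkpos[of k] by (simp add: ek_def scaleR_add_right)
    also have "\<dots> = (x - p) + t k *\<^sub>R (dxk k - duk k)"
      by (simp add: xp lk_def algebra_simps)
    finally show ?thesis by (simp add: algebra_simps)
  qed
  note nk' = regular_normal_resolvent_preimage[OF nk[unfolded xk]]
  have "(\<lambda>k. ak k \<bullet> (v + t k *\<^sub>R ek k) + \<alpha>k k) \<longlonglongrightarrow> a \<bullet> (v + 0 *\<^sub>R e) + \<alpha>"
    by (intro tendsto_intros lims t ek)
  then have ker: "a \<bullet> v + \<alpha> = 0"
    using nk'(2) LIMSEQ_unique[OF _ tendsto_const] by simp
  have "(a + b, lam *\<^sub>R a) \<in> directional_normal_cone B (p, v) (du, e)"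
  proof (rule directional_normal_coneI[OF t])
    show "(\<lambda>k. (duk k, ek k)) \<longlonglongrightarrow> (du, e)" by (intro tendsto_intros lims ek)
    show "(\<lambda>k. (ak k + bk k, lk k *\<^sub>R ak k)) \<longlonglongrightarrow> (a + b, lam *\<^sub>R a)"
      by (intro tendsto_intros lims lk)
    show "(ak k + bk k, lk k *\<^sub>R ak k)
            \<in> regular_normal_cone B ((p, v) + t k *\<^sub>R (duk k, ek k))" for k
      using nk'(3)[of k] by simp
  qed
  then have "(a + b, lam *\<^sub>R a) \<bullet> (du, e) = 0"
    using ss unfolding semismooth_star_set_def v_def[symmetric] by blast
  moreover have "lam * (a \<bullet> e) = a \<bullet> dx - a \<bullet> du - dl * (a \<bullet> v)"
    using lam by (simp add: e_def inner_diff_right del: scaleR_diff_right)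
  ultimately have "a \<bullet> dx + b \<bullet> du - dl * (a \<bullet> v) = 0"
    by (simp add: inner_add_left)
  moreover have "\<alpha> = - (a \<bullet> v)" using ker by simp
  ultimately show "nrm \<bullet> dir = 0"
    by (simp add: nrm dir mult.commute)
qed

section \<open>Semismoothness* of the proximal map\<close>

theorem proposition6:
  fixes f :: "'a::euclidean_space \<Rightarrow> ereal" and x :: 'a and lam :: real
  assumes "f \<in> Gamma0" and "lam > 0"
  shows "(semismooth_star_map (subdifferential f)
            (prox_joint f (x, lam), (1 / lam) *\<^sub>R (x - prox_joint f (x, lam)))
          \<longrightarrow> semismooth_star_on (UNIV \<times> {0<..}) (prox_joint f) (x, lam))
       \<and> (semismooth_star_on UNIV (prox lam f) x
          \<longleftrightarrow> semismooth_star_map (subdifferential f)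
                (prox lam f x, (1 / lam) *\<^sub>R (x - prox lam f x)))"
proof -
  let ?B = "gph (subdifferential f)"
  let ?P = "gph (\<lambda>z. if z \<in> UNIV then {prox lam f z} else {})"
  define L :: "'a \<times> 'a \<Rightarrow> 'a \<times> 'a" where "L = (\<lambda>(y, u). (u, (1 / lam) *\<^sub>R (y - u)))"
  define g :: "'a \<times> 'a \<Rightarrow> 'a \<times> 'a" where "g = (\<lambda>(u, v). (u + lam *\<^sub>R v, u))"
  have L: "linear L" and g: "linear g"
    by (auto simp: L_def g_def linear_iff algebra_simps)
  have Lg: "L (g y) = y" and gL: "g (L y) = y" for y
    using assms(2) by (cases y; simp add: L_def g_def)+
  have P: "?P = L -` ?B"
    by (auto simp: gph_def L_def prox_eq_iff_subgradient[OF assms, symmetric])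
  have B: "?B = g -` ?P"
    unfolding P by (simp add: vimage_def Lg)
  have "gph (\<lambda>z. if z \<in> UNIV \<times> {0<..} then {prox_joint f z} else {}) = resolvent_preimage ?B"
    by (auto simp: gph_def resolvent_preimage_def prox_joint_def
        prox_eq_iff_subgradient[OF assms(1), symmetric] split: if_splits)
  then have joint: "semismooth_star_map (subdifferential f)
            (prox_joint f (x, lam), (1 / lam) *\<^sub>R (x - prox_joint f (x, lam)))
          \<Longrightarrow> semismooth_star_on (UNIV \<times> {0<..}) (prox_joint f) (x, lam)"
    unfolding semismooth_star_on_def semismooth_star_map_def
    using semismooth_star_set_resolvent_preimage[OF assms(2)] by simp
  define p where "p = prox lam f x"
  have Lp: "L (x, p) = (p, (1 / lam) *\<^sub>R (x - p))" by (simp add: L_def)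
  have "semismooth_star_set ?B (L (x, p)) \<Longrightarrow> semismooth_star_set ?P (x, p)"
    unfolding P by (rule semismooth_star_set_linear_vimage[OF L g Lg gL])
  moreover have "semismooth_star_set ?B (L (x, p))" if "semismooth_star_set ?P (x, p)"
  proof -
    have "semismooth_star_set (g -` ?P) (L (x, p))"
      by (rule semismooth_star_set_linear_vimage[OF g L gL Lg]) (use that gL in simp)
    then show ?thesis using B by simp
  qed
  ultimately have "semismooth_star_on UNIV (prox lam f) x
      \<longleftrightarrow> semismooth_star_map (subdifferential f) (p, (1 / lam) *\<^sub>R (x - p))"
    unfolding semismooth_star_on_def semismooth_star_map_def Lp p_def[symmetric] by blast
  with joint show ?thesis unfolding p_def by blast
qed

end
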